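(* Let $A\in\mathbb{R}^{m\times n}$, $b\in\mathbb{R}^m$ satisfy the genericity condition $\widetilde\sigma_n>\sigma_{n+1}$, let $x$ be the unique TLS solution, $r=b-Ax$, $P=A^\top A-\sigma_{n+1}^2I_n$, and let $L\in\mathbb{R}^{k\times n}$ with $k\le n$. Let $\mathcal{V}=\mathbb{R}^k$ be equipped with a norm $\|\cdot\|_{\mathcal V}$, and let $\kappa$ be the condition number at $(A,b)$ of the map $\Psi(A,b)=Lx$, where the data space carries the componentwise norm relative to $(A,b)$ and the solution space carries $\|\cdot\|_{\mathcal V}$. Then $$\kappa=\max_{\|u\|_{\mathcal V^*}=1}\left\|\begin{bmatrix}\mathcal N D_A & \mathcal H D_b\end{bmatrix}^\top L^\top u\right\|_1=\left\|\begin{bmatrix}\mathcal N D_A & \mathcal H D_b\end{bmatrix}^\top L^\top\right\|_{\mathcal V^*,1},$$ where $$\mathcal N=P^{-1}\left[-x^\top\otimes\left(A^\top+\frac{2xr^\top}{1+x^\top x}\right)+I_n\otimes r^\top\right],\qquad \mathcal H=P^{-1}\left[A^\top+\frac{2xr^\top}{1+x^\top x}\right].$$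
   Context: Let $m>n$. The total least squares (TLS) problem for $A\in\mathbb{R}^{m\times n}$, $b\in\mathbb{R}^m$ is to minimize $\|[A,b]-[\widehat A,\widehat b]\|_F$ over $[\widehat A,\widehat b]\in\mathbb{R}^{m\times(n+1)}$ with $\widehat b$ in the range of $\widehat A$; any $x$ with $\widehat A x=\widehat b$ for a minimizer is a TLS solution. Let $\widetilde\sigma_n$ be the smallest singular value of $A$ and $\sigma_{n+1}$ the smallest singular value of $[A,b]$. Under the genericity condition $\widetilde\sigma_n>\sigma_{n+1}$ there is a unique TLS solution $x$; it satisfies $(A^\top A-\sigma_{n+1}^2I_n)x=A^\top b$. $\Psi(A,b)=Lx$ is defined on data satisfying the genericity condition; it is known to be Fréchet differentiable there. Its derivative at $(A,b)$ is denoted $\mathsf d\Psi(A,b)$ and is the linear map $$(\mathsf dA,\mathsf db)\mapsto LP^{-1}\left[(\mathsf dA)^\top r-\left(A^\top+\tfrac{2xr^\top}{1+x^\top x}\right)\mathsf dA\,x\right]+LP^{-1}\left(A^\top+\tfrac{2xr^\top}{1+x^\top x}\right)\mathsf db .$$ Componentwise norm on the data space: $\|(\mathsf dA,\mathsf db)\|_c=\min\{\omega\ge0: |\mathsf dA|\le\omega|A|,\ |\mathsf db|\le\omega|b|\}$ (entrywise absolute values and inequalities), and $=\infty$ if no such $\omega$ exists (so perturbations that are nonzero where the data is zero are excluded). The condition number is $\kappa=\max_{\|(\mathsf dA,\mathsf db)\|_c=1}\|\mathsf d\Psi(A,b)\cdot(\mathsf dA,\mathsf db)\|_{\mathcal V}$.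 $\|\cdot\|_{\mathcal V^*}$ is the dual norm of $\|\cdot\|_{\mathcal V}$ with respect to the canonical inner product of $\mathbb{R}^k$; $\|B\|_{\mathcal V^*,1}=\max_{\|u\|_{\mathcal V^*}=1}\|Bu\|_1$. $\otimes$ is the Kronecker product $[a_{ij}B]$; $\mathrm{vec}$ stacks columns; $D_A$ is the $mn\times mn$ diagonal matrix with diagonal $\mathrm{vec}(A)$ and $D_b$ the $m\times m$ diagonal matrix with diagonal $b$. *)

theory Defs
  imports "HOL-Analysis.Analysis"
begin

section \<open>Maxima and norms\<close>

text \<open>\<open>max_over f S\<close> is meaningful only if the maximum is attained, i.e. if \<open>attains_max f S\<close>.\<close>

definition max_over :: "('a \<Rightarrow> real) \<Rightarrow> 'a set \<Rightarrow> real" where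
  "max_over f S = (GREATEST y. y \<in> f ` S)"

definition attains_max :: "('a \<Rightarrow> real) \<Rightarrow> 'a set \<Rightarrow> bool" where
  "attains_max f S \<longleftrightarrow> (\<exists>x\<in>S. \<forall>y\<in>S. f y \<le> f x)"

definition is_norm :: "('a::real_vector \<Rightarrow> real) \<Rightarrow> bool" where
  "is_norm V \<longleftrightarrow>
     (\<forall>x. 0 \<le> V x) \<and> (\<forall>x. V x = 0 \<longleftrightarrow> x = 0) \<and>
     (\<forall>c x. V (c *\<^sub>R x) = \<bar>c\<bar> * V x) \<and> (\<forall>x y. V (x + y) \<le> V x + V y)"

definition dual_norm :: "(real^'k \<Rightarrow> real) \<Rightarrow> real^'k \<Rightarrow> real" where
  "dual_norm V u = max_over (\<lambda>v. u \<bullet> v) {v. V v = 1}"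

definition norm1 :: "real^'i \<Rightarrow> real" where
  "norm1 v = (\<Sum>i\<in>UNIV. \<bar>v $ i\<bar>)"

definition dual_1_norm :: "(real^'k \<Rightarrow> real) \<Rightarrow> real^'k^'i \<Rightarrow> real" where
  "dual_1_norm V B = max_over (\<lambda>u. norm1 (B *v u)) {u. dual_norm V u = 1}"


section \<open>Matrix constructions\<close>

text \<open>Block matrices have sum types as index types. The rows and columns of a Kronecker product
  are indexed by pairs whose first component selects the block; accordingly, \<open>vec_cols M\<close>,
  which stacks the columns of \<open>M\<close>, has the (column, row) pairs as indices.\<close>

definition hcat :: "real^'n^'m \<Rightarrow> real^'q^'m \<Rightarrow> real^('n + 'q)^'m" where
  "hcat A B = (\<chi> i j. case j of Inl k \<Rightarrow> A $ i $ k | Inr k \<Rightarrow> B $ i $ k)"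

definition kron :: "real^'n^'m \<Rightarrow> real^'q^'p \<Rightarrow> real^('n \<times> 'q)^('m \<times> 'p)" where
  "kron A B = (\<chi> i j. A $ fst i $ fst j * B $ snd i $ snd j)"

definition vec_cols :: "real^'n^'m \<Rightarrow> real^('n \<times> 'm)" where
  "vec_cols M = (\<chi> p. M $ snd p $ fst p)"

definition diag_mat :: "real^'i \<Rightarrow> real^'i^'i" where
  "diag_mat d = (\<chi> i j. if i = j then d $ i else 0)"

text \<open>If one factor of a Kronecker product is a single row, its rows are indexed by
  \<open>1 \<times> 'n\<close> or \<open>'n \<times> 1\<close>; these two functions identify both index types with \<open>'n\<close>.\<close>

definition drop_fst_row :: "real^'q^(1 \<times> 'n) \<Rightarrow> real^'q^'n" where
  "drop_fst_row M = (\<chi> i. M $ (1, i))"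

definition drop_snd_row :: "real^'q^('n \<times> 1) \<Rightarrow> real^'q^'n" where
  "drop_snd_row M = (\<chi> i. M $ (i, 1))"


section \<open>Singular values\<close>

definition singular_value :: "real^'n^'m \<Rightarrow> real \<Rightarrow> bool" where
  "singular_value A s \<longleftrightarrow>
     0 \<le> s \<and> (\<exists>u v. norm u = 1 \<and> norm v = 1 \<and> A *v v = s *\<^sub>R u \<and> transpose A *v u = s *\<^sub>R v)"

definition sigma_min :: "real^'n^'m \<Rightarrow> real" where
  "sigma_min A = (LEAST s. singular_value A s)"


section \<open>Total least squares\<close>

definition augment :: "real^'n^'m \<Rightarrow> real^'m \<Rightarrow> real^('n + 1)^'m" where
  "augment A b = hcat A (columnvector b)"

text \<open>\<open>norm\<close> on a matrix type is the Frobenius norm.\<close>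

definition tls_minimizer ::
  "real^'n^'m \<Rightarrow> real^'m \<Rightarrow> real^'n^'m \<Rightarrow> real^'m \<Rightarrow> bool" where
  "tls_minimizer A b A' b' \<longleftrightarrow>
     b' \<in> range (\<lambda>y. A' *v y) \<and>
     (\<forall>C d. d \<in> range (\<lambda>y. C *v y) \<longrightarrow>
        norm (augment A b - augment A' b') \<le> norm (augment A b - augment C d))"

definition tls_solution :: "real^'n^'m \<Rightarrow> real^'m \<Rightarrow> real^'n \<Rightarrow> bool" where
  "tls_solution A b x \<longleftrightarrow> (\<exists>A' b'. tls_minimizer A b A' b' \<and> A' *v x = b')"

definition tls_generic :: "real^'n^'m \<Rightarrow> real^'m \<Rightarrow> bool" where
  "tls_generic A b \<longleftrightarrow> sigma_min A > sigma_min (augment A b)"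

text \<open>The values of \<open>tls_map L\<close> matter only on generic data, which form an open set.\<close>

definition tls_map :: "real^'n^'k \<Rightarrow> (real^'n^'m) \<times> (real^'m) \<Rightarrow> real^'k" where
  "tls_map L = (\<lambda>(A, b). L *v (THE x. tls_solution A b x))"


section \<open>The componentwise condition number\<close>

definition comp_bound ::
  "(real^'n^'m) \<times> (real^'m) \<Rightarrow> (real^'n^'m) \<times> (real^'m) \<Rightarrow> real \<Rightarrow> bool" where
  "comp_bound = (\<lambda>(A, b) (dA, db) \<omega>.
     0 \<le> \<omega> \<and> (\<forall>i j. \<bar>dA $ i $ j\<bar> \<le> \<omega> * \<bar>A $ i $ j\<bar>) \<and> (\<forall>i. \<bar>db $ i\<bar> \<le> \<omega> * \<bar>b $ i\<bar>))"

definition comp_norm ::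
  "(real^'n^'m) \<times> (real^'m) \<Rightarrow> (real^'n^'m) \<times> (real^'m) \<Rightarrow> ereal" where
  "comp_norm D E =
     (if \<exists>\<omega>. comp_bound D E \<omega> then ereal (LEAST \<omega>. comp_bound D E \<omega>) else \<infinity>)"

definition perturbed_size ::
  "real^'n^'k \<Rightarrow> (real^'k \<Rightarrow> real) \<Rightarrow> (real^'n^'m) \<times> (real^'m) \<Rightarrow>
     (real^'n^'m) \<times> (real^'m) \<Rightarrow> real" where
  "perturbed_size L V D E = V (frechet_derivative (tls_map L) (at D) E)"

definition tls_cond ::
  "real^'n^'k \<Rightarrow> (real^'k \<Rightarrow> real) \<Rightarrow> (real^'n^'m) \<times> (real^'m) \<Rightarrow> real" where
  "tls_cond L V D = max_over (perturbed_size L V D) {E. comp_norm D E = 1}"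

end

theory Submission
  imports Defs
begin

text \<open>
  If \<open>y\<close> is prescribed, the cheapest change of \<open>[A, b]\<close> to some \<open>[A', b']\<close> with \<open>A' y = b'\<close> has rank at
  most one and squared Frobenius size \<open>\<bar>b - A y\<bar>\<^sup>2 / (1 + \<bar>y\<bar>\<^sup>2)\<close>. Hence TLS solutions are the minimizers of this
  function, which is the Rayleigh quotient of \<open>[A, b]\<^sup>T [A, b]\<close> at \<open>(y, -1)\<close>
  (\<open>tls_solution_iff_minimizes_objective\<close>). Genericity forces the last component of a minimal right
  singular vector of \<open>[A, b]\<close> to be nonzero, so the minimum is \<open>\<mu> = \<sigma>\<^sub>n\<^sub>+\<^sub>1\<^sup>2\<close>; writing out the
  eigenvector equation gives \<open>A\<^sup>T r = - \<mu> x\<close>, equivalently \<open>P x = A\<^sup>T b\<close>. By genericity \<open>P\<close> is positive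
  definite, which yields uniqueness and, quantitatively, continuity of the solution in the data.

  For the derivative, \<open>x\<close> is regarded as a root of \<open>A\<^sup>T r + (\<bar>r\<bar>\<^sup>2 / (1 + \<bar>x\<bar>\<^sup>2)) x\<close>. The quotient in this
  expression is itself minimal at \<open>x\<close>, so its partial derivative in \<open>x\<close> vanishes and the partial
  derivative of the whole expression in \<open>x\<close> is just \<open>- P\<close>; its partial derivative in the data produces
  the rank-one term of \<open>G\<close>. Implicit differentiation then gives the Frechet derivative
  (\<open>tls_point_has_derivative\<close>).

  A perturbation is within the componentwise unit ball precisely if it multiplies every entry of the
  data by a factor in \<open>[-1, 1]\<close>. In terms of the vector \<open>t\<close> of these factors the derivative
  of \<open>L x\<close> is \<open>L K t\<close>. Since \<open>V\<close> is the maximum of the functionals in the dual unit sphere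
  (\<open>ex_norming_functional\<close>), exchanging two maxima gives
  \<open>max\<^sub>t V (L K t) = max\<^sub>u max\<^sub>t (K\<^sup>T L\<^sup>T u) \<bullet> t = max\<^sub>u \<bar>K\<^sup>T L\<^sup>T u\<bar>\<^sub>1\<close>. The inner maximum is attained at a sign
  vector \<open>t\<close>, and the corresponding perturbation has the same absolute values as the data, hence
  componentwise norm exactly one.
\<close>

section \<open>The least singular value\<close>

lemma norm_matrix_vector_le: "norm (M *v v) \<le> norm M * norm v"
  for M :: "real^'n^'m"
proof -
  have "norm (M *v v) \<le> L2_set (\<lambda>i. norm (M $ i) * norm v) UNIV"
    unfolding norm_vec_def[of "M *v v"]
    by (rule L2_set_mono) (auto simp: matrix_vector_mul_component Cauchy_Schwarz_ineq2)
  also have "\<dots> = norm M * norm v"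
    by (simp add: norm_vec_def[of M] L2_set_left_distrib)
  finally show ?thesis .
qed

text \<open>
  This extracts a first-order condition from a minimum: if \<open>a\<close> were nonzero, the linear term would
  win over the quadratic one for small \<open>t\<close> of the opposite sign.
\<close>
lemma nonneg_quadratic_imp_linear_zero:
  fixes a c :: real
  assumes "\<And>t. 0 \<le> 2 * t * a + t\<^sup>2 * c"
  shows "a = 0"
proof (rule ccontr)
  assume "a \<noteq> 0"
  \<comment> \<open>Replacing \<open>c\<close> by a positive upper bound lets the quadratic be minimized in closed form.\<close>
  define k where "k = \<bar>c\<bar> + 1"
  have k: "0 < k" "c \<le> k" by (auto simp: k_def)
  define t where "t = - a / k"
  have "t\<^sup>2 * c \<le> t\<^sup>2 * k"
    using k by (intro mult_left_mono) auto
  also have "\<dots> = a\<^sup>2 / k"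
    using k by (simp add: t_def power2_eq_square)
  finally have "2 * t * a + t\<^sup>2 * c \<le> - (a\<^sup>2 / k)"
    by (simp add: t_def power2_eq_square)
  moreover have "0 < a\<^sup>2 / k" using k \<open>a \<noteq> 0\<close> by simp
  ultimately show False using assms[of t] by linarith
qed

text \<open>
  The quadratic form \<open>\<bar>M w\<bar>\<^sup>2 - s \<bar>w\<bar>\<^sup>2\<close> is nonnegative and vanishes at \<open>v\<close>, so its gradient at \<open>v\<close>
  vanishes too.
\<close>
lemma least_stretch_eigenvector:
  fixes M :: "real^'n^'m"
  assumes low: "\<And>w. s * (w \<bullet> w) \<le> (M *v w) \<bullet> (M *v w)"
    and eq: "(M *v v) \<bullet> (M *v v) = s * (v \<bullet> v)"
  shows "transpose M *v (M *v v) = s *\<^sub>R v"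
proof -
  have "(transpose M *v (M *v v) - s *\<^sub>R v) \<bullet> h = 0" for h
  proof -
    let ?a = "(M *v v) \<bullet> (M *v h) - s * (v \<bullet> h)"
    have "0 \<le> 2 * t * ?a + t\<^sup>2 * ((M *v h) \<bullet> (M *v h) - s * (h \<bullet> h))" for t
      using low[of "v + t *\<^sub>R h"] eq
      by (simp add: matrix_vector_right_distrib matrix_vector_mult_scaleR inner_add_left
          inner_add_right inner_commute power2_eq_square algebra_simps)
    then have "?a = 0" by (rule nonneg_quadratic_imp_linear_zero)
    then show ?thesis
      by (simp add: inner_diff_left dot_lmul_matrix)
  qed
  then have "transpose M *v (M *v v) - s *\<^sub>R v = 0"
    using inner_eq_zero_iff by blast
  then show ?thesis by simp
qed

lemma ex_least_stretch:
  fixes M :: "real^'n^'m"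
  obtains v where "norm v = 1" "\<And>w. norm (M *v v) * norm w \<le> norm (M *v w)"
proof -
  have "\<exists>v\<in>sphere 0 1. \<forall>w\<in>sphere 0 1. norm (M *v v) \<le> norm (M *v w)"
    by (intro continuous_attains_inf continuous_intros) auto
  then obtain v where v: "v \<in> sphere 0 1"
    and le: "\<And>w. w \<in> sphere 0 1 \<Longrightarrow> norm (M *v v) \<le> norm (M *v w)"
    by auto
  have "norm (M *v v) * norm w \<le> norm (M *v w)" for w
  proof (cases "w = 0")
    case False
    have "norm (M *v v) \<le> norm (M *v (w /\<^sub>R norm w))"
      using False by (intro le) simp
    then show ?thesis
      using False by (simp add: matrix_vector_mult_scaleR field_simps)
  qed simp
  then show ?thesis using v that by simp
qed

text \<open>
  The least value of \<open>\<bar>M v\<bar>\<close> on the unit sphere is a singular value, with left singular vector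
  \<open>M v / \<bar>M v\<bar>\<close>. If that value is \<open>0\<close>, a left singular vector must come from the kernel of \<open>M\<^sup>T\<close>; this
  kernel is nontrivial because the rank of \<open>M\<close> is less than the number of columns, which does not
  exceed the number of rows.
\<close>
lemma sigma_min_attained:
  fixes M :: "real^'n^'m"
  assumes card: "CARD('n) \<le> CARD('m)"
  obtains v where "norm v = 1" "norm (M *v v) = sigma_min M"
    "\<And>w. sigma_min M * norm w \<le> norm (M *v w)"
proof -
  obtain v where v: "norm v = 1" and low: "\<And>w. norm (M *v v) * norm w \<le> norm (M *v w)"
    using ex_least_stretch[of M] by blast
  let ?s = "norm (M *v v)"
  have eig: "transpose M *v (M *v v) = ?s\<^sup>2 *\<^sub>R v"
  proof (rule least_stretch_eigenvector)
    show "?s\<^sup>2 * (w \<bullet> w) \<le> (M *v w) \<bullet> (M *v w)" for w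
      using power_mono[OF low[of w], of 2]
      by (simp add: power_mult_distrib flip: power2_norm_eq_inner)
    show "(M *v v) \<bullet> (M *v v) = ?s\<^sup>2 * (v \<bullet> v)"
      using v by (simp flip: power2_norm_eq_inner)
  qed
  have "singular_value M ?s"
  proof (cases "?s = 0")
    case True
    then have "M *v v = 0" "v \<noteq> 0" using v by auto
    then have "\<not> inj ((*v) M)"
      by (metis injD matrix_vector_mult_0_right)
    then have "rank M \<noteq> CARD('n)"
      by (simp add: full_rank_injective)
    then have "rank (transpose M) < CARD('m)"
      using rank_bound[of M] card by (simp add: rank_transpose)
    then obtain u where u: "u \<noteq> 0" "transpose M *v u = 0"
      using matrix_nonfull_linear_equations_eq[of "transpose M"] by auto
    show ?thesis
      unfolding singular_value_def
      apply (rule conjI, simp)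
      apply (rule exI[of _ "u /\<^sub>R norm u"], rule exI[of _ v])
      using u v True by (simp add: matrix_vector_mult_scaleR del: transpose_matrix_vector)
  next
    case False
    show ?thesis
      unfolding singular_value_def
      apply (rule conjI, simp)
      apply (rule exI[of _ "(M *v v) /\<^sub>R ?s"], rule exI[of _ v])
      using v False eig by (simp add: matrix_vector_mult_scaleR power2_eq_square del: transpose_matrix_vector)
  qed
  moreover have "?s \<le> t" if sv: "singular_value M t" for t
  proof -
    obtain u w where "0 \<le> t" "norm u = 1" "norm w = 1" "M *v w = t *\<^sub>R u"
      using sv unfolding singular_value_def by auto
    then show ?thesis using low[of w] by simp
  qed
  ultimately have "sigma_min M = ?s"
    unfolding sigma_min_def by (rule Least_equality)
  then show ?thesis using that v low by simp
qed

text \<open>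
  The minimal stretch of one matrix is bounded by its value on a minimizer for the other.
\<close>
lemma sigma_min_Lipschitz:
  fixes M N :: "real^'n^'m"
  assumes "CARD('n) \<le> CARD('m)"
  shows "\<bar>sigma_min M - sigma_min N\<bar> \<le> norm (M - N)"
proof -
  have le: "sigma_min B \<le> sigma_min C + norm (B - C)" for B C :: "real^'n^'m"
  proof -
    obtain v where v: "norm v = 1" "norm (C *v v) = sigma_min C"
      by (rule sigma_min_attained[OF assms, of C])
    have "sigma_min B * norm v \<le> norm (B *v v)"
      by (rule sigma_min_attained[OF assms, of B]) blast
    moreover have "norm (B *v v) \<le> norm (C *v v) + norm ((B - C) *v v)"
      using norm_triangle_ineq[of "C *v v" "(B - C) *v v"]
      by (simp add: matrix_vector_mult_diff_rdistrib)
    moreover have "norm ((B - C) *v v) \<le> norm (B - C)"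
      using norm_matrix_vector_le[of "B - C" v] v by simp
    ultimately show ?thesis using v by simp
  qed
  show ?thesis
    using le[of M N] le[of N M] by (simp add: norm_minus_commute abs_le_iff)
qed

lemma continuous_on_sigma_min:
  assumes "CARD('n) \<le> CARD('m)"
  shows "continuous_on S (sigma_min :: real^'n^'m \<Rightarrow> real)"
proof (unfold continuous_on_iff, intro ballI allI impI)
  fix M :: "real^'n^'m" and e :: real assume "0 < e"
  moreover have "dist (sigma_min N) (sigma_min M) \<le> dist N M" for N :: "real^'n^'m"
    using sigma_min_Lipschitz[OF assms, of N M] by (simp add: dist_norm)
  ultimately show "\<exists>d>0. \<forall>N\<in>S. dist N M < d \<longrightarrow> dist (sigma_min N) (sigma_min M) < e"
    by (intro exI[of _ e]) (auto intro: le_less_trans)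
qed

section \<open>Norms on Euclidean space and their duals\<close>

lemma max_over_eqI:
  assumes "x \<in> S" "\<And>y. y \<in> S \<Longrightarrow> f y \<le> f x"
  shows "max_over f S = f x"
  unfolding max_over_def using assms by (intro Greatest_equality) auto

lemma attains_max_compact:
  fixes f :: "'a::topological_space \<Rightarrow> real"
  assumes "compact S" "S \<noteq> {}" "continuous_on S f"
  shows "attains_max f S"
  unfolding attains_max_def using continuous_attains_sup[OF assms] .

context
  fixes V :: "'a::euclidean_space \<Rightarrow> real"
  assumes V: "is_norm V"
begin

lemma is_norm_nonneg: "0 \<le> V x"
  and is_norm_eq_0: "V x = 0 \<longleftrightarrow> x = 0"
  and is_norm_scale: "V (c *\<^sub>R x) = \<bar>c\<bar> * V x"
  and is_norm_triangle: "V (x + y) \<le> V x + V y"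
  using V unfolding is_norm_def by blast+

lemma is_norm_pos: "x \<noteq> 0 \<Longrightarrow> 0 < V x"
  using is_norm_nonneg[of x] is_norm_eq_0[of x] by linarith

lemma is_norm_sum: "finite S \<Longrightarrow> V (sum f S) \<le> (\<Sum>i\<in>S. V (f i))"
proof (induction S rule: finite_induct)
  case empty
  then show ?case using is_norm_eq_0[of 0] by simp
next
  case (insert i S)
  then show ?case using is_norm_triangle[of "f i" "sum f S"] by simp
qed

lemma is_norm_le_Euclidean: "\<exists>C. \<forall>x. V x \<le> C * norm x"
proof (intro exI allI)
  fix x :: 'a
  have "V x = V (\<Sum>i\<in>Basis. (x \<bullet> i) *\<^sub>R i)"
    by (simp add: euclidean_representation)
  also have "\<dots> \<le> (\<Sum>i\<in>Basis. V ((x \<bullet> i) *\<^sub>R i))"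
    by (rule is_norm_sum) simp
  also have "\<dots> \<le> (\<Sum>i\<in>Basis. norm x * V i)"
    by (intro sum_mono) (simp add: is_norm_scale is_norm_nonneg Basis_le_norm mult_right_mono)
  finally show "V x \<le> (\<Sum>i\<in>Basis. V i) * norm x"
    by (simp add: sum_distrib_left mult.commute)
qed

lemma continuous_on_is_norm: "continuous_on S V"
proof -
  obtain C where C: "\<And>x. V x \<le> C * norm x"
    using is_norm_le_Euclidean by blast
  have diff: "V x - V y \<le> C * norm (x - y)" for x y
    using is_norm_triangle[of "x - y" y] C[of "x - y"] by simp
  have "\<bar>V x - V y\<bar> \<le> C * norm (x - y)" for x y
    using diff[of x y] diff[of y x] by (simp add: norm_minus_commute abs_le_iff)
  then have "\<bar>V x - V y\<bar> \<le> \<bar>C\<bar> * norm (x - y)" for x y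
    by (rule order_trans) (simp add: mult_right_mono)
  then have "\<bar>C\<bar>-lipschitz_on S V"
    by (intro lipschitz_onI) (auto simp: dist_norm)
  then show ?thesis by (rule lipschitz_on_continuous_on)
qed

lemma is_norm_ge_Euclidean: "\<exists>c>0. \<forall>x. c * norm x \<le> V x"
proof -
  have "\<exists>z\<in>sphere 0 1. \<forall>x\<in>sphere 0 1. V z \<le> V x"
    by (intro continuous_attains_inf continuous_on_is_norm) auto
  then obtain z where z: "norm z = 1" and le: "\<And>x. norm x = 1 \<Longrightarrow> V z \<le> V x"
    by auto
  have "V z * norm x \<le> V x" for x
  proof (cases "x = 0")
    case False
    then show ?thesis
      using le[of "x /\<^sub>R norm x"] by (simp add: is_norm_scale field_simps)
  qed (simp add: is_norm_nonneg)
  moreover have "0 < V z" using z by (intro is_norm_pos) auto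
  ultimately show ?thesis by blast
qed

lemma compact_unit_sphere_is_norm: "compact {x. V x = 1}"
proof -
  obtain c where c: "0 < c" "\<And>x. c * norm x \<le> V x"
    using is_norm_ge_Euclidean by blast
  have "norm x \<le> 1 / c" if "V x = 1" for x
    using c(1) c(2)[of x] that by (simp add: field_simps)
  then have "bounded {x. V x = 1}"
    unfolding bounded_iff by blast
  moreover have "closed {x. V x = 1}"
    by (intro closed_Collect_eq continuous_on_is_norm continuous_on_const)
  ultimately show ?thesis by (simp add: compact_eq_bounded_closed)
qed

lemma unit_sphere_is_norm_nonempty: "{x. V x = 1} \<noteq> {}"
proof -
  obtain z :: 'a where "z \<noteq> 0"
    using nonzero_Basis nonempty_Basis by blast
  then have "V (z /\<^sub>R V z) = 1"
    using is_norm_pos[of z] by (simp add: is_norm_scale)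
  then show ?thesis by blast
qed

end

text \<open>
  Compactness of the unit sphere of \<open>V\<close> makes the maximum that defines the dual norm a genuine one,
  and homogeneity extends the bound from the sphere to all vectors.
\<close>
lemma dual_norm_attained:
  assumes V: "is_norm V"
  obtains v where "V v = 1" "u \<bullet> v = dual_norm V u" "\<And>w. u \<bullet> w \<le> dual_norm V u * V w"
proof -
  have "attains_max (\<lambda>v. u \<bullet> v) {v. V v = 1}"
    by (intro attains_max_compact compact_unit_sphere_is_norm unit_sphere_is_norm_nonempty V
        continuous_intros)
  then obtain v where v: "V v = 1" and max: "\<And>w. V w = 1 \<Longrightarrow> u \<bullet> w \<le> u \<bullet> v"
    unfolding attains_max_def by auto
  have eq: "dual_norm V u = u \<bullet> v"
    unfolding dual_norm_def using v max by (intro max_over_eqI) auto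
  have "u \<bullet> w \<le> dual_norm V u * V w" for w
  proof (cases "w = 0")
    case True
    then show ?thesis using is_norm_eq_0[OF V, of w] by simp
  next
    case False
    then have "0 < V w" by (rule is_norm_pos[OF V])
    then show ?thesis
      using max[of "w /\<^sub>R V w"] by (simp add: is_norm_scale[OF V] eq field_simps)
  qed
  then show ?thesis using that v eq by simp
qed

lemma dual_norm_Hoelder:
  assumes "is_norm V" shows "u \<bullet> v \<le> dual_norm V u * V v"
  using dual_norm_attained[OF assms, of u] by blast

lemma is_norm_dual_norm:
  assumes V: "is_norm V"
  shows "is_norm (dual_norm V)"
proof -
  let ?W = "dual_norm V"
  have nonneg: "0 \<le> ?W u" for u
  proof -
    obtain v where v: "V v = 1" "u \<bullet> v = ?W u"
      using dual_norm_attained[OF V, of u] by metis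
    then show ?thesis
      using dual_norm_Hoelder[OF V, of u "(-1) *\<^sub>R v"] is_norm_scale[OF V, of "-1" v] by simp
  qed
  have zero: "?W u = 0 \<longleftrightarrow> u = 0" for u
  proof
    assume "?W u = 0"
    then show "u = 0" using dual_norm_Hoelder[OF V, of u u] inner_ge_zero[of u]
      by (simp add: order_antisym)
  next
    assume "u = 0"
    then show "?W u = 0" using dual_norm_attained[OF V, of u] by (metis inner_zero_left)
  qed
  have scale: "?W (c *\<^sub>R u) = \<bar>c\<bar> * ?W u" for c u
  proof (rule antisym)
    obtain v where "V v = 1" "(c *\<^sub>R u) \<bullet> v = ?W (c *\<^sub>R u)"
      using dual_norm_attained[OF V, of "c *\<^sub>R u"] by metis
    then show "?W (c *\<^sub>R u) \<le> \<bar>c\<bar> * ?W u"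
      using dual_norm_Hoelder[OF V, of u "c *\<^sub>R v"] by (simp add: is_norm_scale[OF V] mult.commute)
  next
    obtain v where v: "V v = 1" "u \<bullet> v = ?W u"
      using dual_norm_attained[OF V, of u] by metis
    \<comment> \<open>Testing with \<open>sgn c\<close> instead of dividing by \<open>c\<close> covers \<open>c = 0\<close>.\<close>
    have "\<bar>c\<bar> * ?W u = (c *\<^sub>R u) \<bullet> (sgn c *\<^sub>R v)"
      using v by (simp add: abs_sgn)
    also have "\<dots> \<le> ?W (c *\<^sub>R u) * \<bar>sgn c\<bar>"
      using dual_norm_Hoelder[OF V, of "c *\<^sub>R u" "sgn c *\<^sub>R v"] v by (simp add: is_norm_scale[OF V])
    also have "\<dots> \<le> ?W (c *\<^sub>R u)"
      using nonneg by (simp add: abs_sgn_eq)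
    finally show "\<bar>c\<bar> * ?W u \<le> ?W (c *\<^sub>R u)" .
  qed
  have triangle: "?W (u + w) \<le> ?W u + ?W w" for u w
  proof -
    obtain v where "V v = 1" "(u + w) \<bullet> v = ?W (u + w)"
      using dual_norm_attained[OF V, of "u + w"] by metis
    then show ?thesis
      using dual_norm_Hoelder[OF V, of u v] dual_norm_Hoelder[OF V, of w v]
      by (simp add: inner_add_left)
  qed
  show ?thesis unfolding is_norm_def using nonneg zero scale triangle by blast
qed

text \<open>
  The finite-dimensional Hahn-Banach theorem: a hyperplane separating the open unit ball of \<open>V\<close> from the
  boundary point \<open>v / V v\<close>, suitably normalized, is the required functional.
\<close>
lemma ex_norming_functional:
  assumes V: "is_norm V"
  obtains u where "dual_norm V u = 1" "u \<bullet> v = V v"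
proof (cases "v = 0")
  case True
  obtain u where "dual_norm V u = 1"
    using unit_sphere_is_norm_nonempty[OF is_norm_dual_norm[OF V]] by blast
  then show ?thesis using that True is_norm_eq_0[OF V, of v] by simp
next
  case False
  then have Vv: "0 < V v" by (rule is_norm_pos[OF V])
  define z where "z = v /\<^sub>R V v"
  have z: "V z = 1" using Vv by (simp add: z_def is_norm_scale[OF V])
  let ?B = "{w. V w < 1}"
  have V0: "V 0 = 0" using is_norm_eq_0[OF V] by simp
  have "convex ?B"
  proof (rule convexI)
    fix x y and s t :: real
    assume xy: "x \<in> ?B" "y \<in> ?B" and st: "0 \<le> s" "0 \<le> t" "s + t = 1"
    have "V (s *\<^sub>R x + t *\<^sub>R y) \<le> s * V x + t * V y"
      using is_norm_triangle[OF V, of "s *\<^sub>R x" "t *\<^sub>R y"] st by (simp add: is_norm_scale[OF V])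
    also have "\<dots> < 1"
      using xy st by (intro convex_bound_lt) auto
    finally show "s *\<^sub>R x + t *\<^sub>R y \<in> ?B" by simp
  qed
  moreover have "0 \<in> ?B" using V0 by simp
  moreover have "?B \<inter> {z} = {}" using z by simp
  ultimately obtain a \<beta> where a: "a \<noteq> 0" and "\<forall>w\<in>?B. a \<bullet> w \<le> \<beta>" "\<forall>w\<in>{z}. \<beta> \<le> a \<bullet> w"
    using separating_hyperplane_sets[of ?B "{z}"] by auto
  then have sep: "a \<bullet> w \<le> a \<bullet> z" if "V w < 1" for w
    using that by force
  have le: "a \<bullet> w \<le> (a \<bullet> z) * V w" for w
  proof (cases "w = 0")
    case True
    then show ?thesis using V0 by simp
  next
    case False
    then have Vw: "0 < V w" by (rule is_norm_pos[OF V])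
    \<comment> \<open>The separation concerns the open ball, so the unit vector \<open>w / V w\<close> is approached from inside.\<close>
    have "(a \<bullet> w) / V w \<le> a \<bullet> z"
    proof (rule field_le_mult_one_interval)
      fix t :: real assume "0 < t" "t < 1"
      then show "t * ((a \<bullet> w) / V w) \<le> a \<bullet> z"
        using sep[of "(t / V w) *\<^sub>R w"] Vw by (simp add: is_norm_scale[OF V])
    qed
    then show ?thesis using Vw by (simp add: field_simps)
  qed
  have "0 < (a \<bullet> z) * V a" using le[of a] a by (meson inner_gt_zero_iff less_le_trans)
  then have az: "0 < a \<bullet> z" using is_norm_nonneg[OF V, of a] by (simp add: zero_less_mult_iff)
  define u where "u = a /\<^sub>R (a \<bullet> z)"
  have uz: "u \<bullet> z = 1" using az by (simp add: u_def)
  have "dual_norm V u = u \<bullet> z"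
    unfolding dual_norm_def
  proof (rule max_over_eqI)
    show "z \<in> {v. V v = 1}" using z by simp
    fix w assume "w \<in> {v. V v = 1}"
    then show "u \<bullet> w \<le> u \<bullet> z" using le[of w] az by (simp add: u_def field_simps)
  qed
  moreover have "u \<bullet> v = V v" using uz Vv by (simp add: z_def field_simps)
  ultimately show ?thesis using that uz by simp
qed

lemma inner_le_norm1:
  assumes "\<And>i. \<bar>t $ i\<bar> \<le> 1"
  shows "w \<bullet> t \<le> norm1 w"
proof -
  have "w $ i * t $ i \<le> \<bar>w $ i\<bar>" for i
  proof -
    have "w $ i * t $ i \<le> \<bar>w $ i\<bar> * \<bar>t $ i\<bar>" by (simp flip: abs_mult)
    also have "\<dots> \<le> \<bar>w $ i\<bar>" using assms[of i] by (simp add: mult_left_le)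
    finally show ?thesis .
  qed
  then show ?thesis unfolding inner_vec_def norm1_def by (auto intro: sum_mono)
qed

text \<open>
  Exchange of maxima: \<open>V (B t)\<close> is the largest \<open>u \<bullet> B t = B\<^sup>T u \<bullet> t\<close> with \<open>u\<close> in the dual unit sphere, and
  over the cube the linear function \<open>t \<mapsto> w \<bullet> t\<close> has maximum \<open>norm1 w\<close>, attained where \<open>t\<close> collects the
  signs of \<open>w\<close>. A zero entry of \<open>w\<close> is given the sign \<open>1\<close>, so that the maximizer is a vertex of
  the cube.
\<close>
lemma norm_cube_duality:
  fixes B :: "real^'i^'k"
  assumes V: "is_norm V"
  defines "g \<equiv> (\<lambda>u. norm1 (transpose B *v u))"
  shows "attains_max g {u. dual_norm V u = 1}"
    and "(\<And>i. \<bar>t $ i\<bar> \<le> 1) \<Longrightarrow> V (B *v t) \<le> max_over g {u. dual_norm V u = 1}"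
    and "\<exists>t. (\<forall>i. \<bar>t $ i\<bar> = 1) \<and> V (B *v t) = max_over g {u. dual_norm V u = 1}"
proof -
  let ?S = "{u. dual_norm V u = 1}"
  note W = is_norm_dual_norm[OF V]
  have cont: "continuous_on ?S g"
    unfolding g_def norm1_def
    by (intro continuous_intros)
  show att: "attains_max g ?S"
    by (intro attains_max_compact compact_unit_sphere_is_norm[OF W] unit_sphere_is_norm_nonempty[OF W]
        cont)
  then obtain u where u: "dual_norm V u = 1" and umax: "\<And>w. dual_norm V w = 1 \<Longrightarrow> g w \<le> g u"
    unfolding attains_max_def by auto
  have max: "max_over g ?S = g u" using u umax by (intro max_over_eqI) auto
  show le: "V (B *v t) \<le> max_over g ?S" if t: "\<And>i. \<bar>t $ i\<bar> \<le> 1" for t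
  proof -
    obtain w where w: "dual_norm V w = 1" "w \<bullet> (B *v t) = V (B *v t)"
      using ex_norming_functional[OF V] by blast
    have "V (B *v t) = (transpose B *v w) \<bullet> t"
      using w by (simp add: dot_lmul_matrix)
    also have "\<dots> \<le> g w" unfolding g_def using t by (rule inner_le_norm1)
    finally show ?thesis using umax[OF w(1)] max by simp
  qed
  define t :: "real^'i" where "t = (\<chi> i. if 0 \<le> (transpose B *v u) $ i then 1 else -1)"
  have t: "\<bar>t $ i\<bar> = 1" for i by (simp add: t_def)
  have "g u = (transpose B *v u) \<bullet> t"
    unfolding g_def norm1_def inner_vec_def by (intro sum.cong) (auto simp: t_def)
  also have "\<dots> = u \<bullet> (B *v t)" by (simp add: dot_lmul_matrix)
  also have "\<dots> \<le> V (B *v t)" using dual_norm_Hoelder[OF V, of u "B *v t"] u by simp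
  finally have "V (B *v t) = max_over g ?S" using le[of t] t max by simp
  then show "\<exists>t. (\<forall>i. \<bar>t $ i\<bar> = 1) \<and> V (B *v t) = max_over g ?S" using t by blast
qed

section \<open>Total least squares solutions\<close>

definition snoc_vec :: "real^'n \<Rightarrow> real \<Rightarrow> real^('n + 1)" where
  "snoc_vec y c = (\<chi> j. case j of Inl k \<Rightarrow> y $ k | Inr _ \<Rightarrow> c)"

lemma sum_UNIV_sum:
  fixes f :: "'a::finite + 'b::finite \<Rightarrow> 'c::comm_monoid_add"
  shows "(\<Sum>j\<in>UNIV. f j) = (\<Sum>i\<in>UNIV. f (Inl i)) + (\<Sum>k\<in>UNIV. f (Inr k))"
  by (subst UNIV_Plus_UNIV[symmetric], subst sum.Plus) auto

lemma snoc_vec_cases: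
  fixes z :: "real^('n::finite + 1)"
  obtains y c where "z = snoc_vec y c"
proof
  show "z = snoc_vec (\<chi> j. z $ Inl j) (z $ Inr 1)"
    by (auto simp: snoc_vec_def vec_eq_iff split: sum.split)
qed

lemma inner_snoc_vec: "snoc_vec y c \<bullet> snoc_vec z d = y \<bullet> z + c * d"
  by (simp add: inner_vec_def sum_UNIV_sum snoc_vec_def UNIV_1)

lemma augment_mult_snoc_vec: "augment A b *v snoc_vec y c = A *v y + c *\<^sub>R b"
  by (simp add: vec_eq_iff matrix_vector_mult_def sum_UNIV_sum snoc_vec_def augment_def hcat_def
      columnvector_def UNIV_1 mult.commute)

lemma augment_diff: "augment A b - augment C d = augment (A - C) (b - d)"
  by (auto simp: vec_eq_iff augment_def hcat_def columnvector_def split: sum.split)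

lemma norm_augment: "(norm (augment A b))\<^sup>2 = (norm A)\<^sup>2 + (norm b)\<^sup>2"
  by (simp add: power2_norm_eq_inner inner_vec_def sum_UNIV_sum augment_def hcat_def
      columnvector_def UNIV_1 sum.distrib)

definition outer :: "real^'m \<Rightarrow> real^'n \<Rightarrow> real^'n^'m" where
  "outer r y = (\<chi> i j. r $ i * y $ j)"

lemma outer_mult: "outer r y *v w = (y \<bullet> w) *\<^sub>R r"
  by (simp add: outer_def vec_eq_iff matrix_vector_mult_def inner_vec_def sum_distrib_left
      mult.commute mult.left_commute)

lemma norm_outer: "norm (outer r y) = norm r * norm y"
proof -
  have "(norm (outer r y))\<^sup>2 = (norm r * norm y)\<^sup>2"
    unfolding power_mult_distrib power2_norm_eq_inner inner_vec_def sum_product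
    by (simp add: outer_def inner_vec_def mult.commute mult.left_commute)
  then show ?thesis by (simp add: power2_eq_iff_nonneg)
qed

definition tls_objective :: "real^'n^'m \<Rightarrow> real^'m \<Rightarrow> real^'n \<Rightarrow> real" where
  "tls_objective A b y = (norm (b - A *v y))\<^sup>2 / (1 + y \<bullet> y)"

lemma one_plus_inner_pos: "0 < 1 + (y::'a::real_inner) \<bullet> y"
  by (rule add_pos_nonneg) auto

lemma augment_mult_minus_one: "augment A b *v snoc_vec y (-1) = - (b - A *v y)"
  by (simp add: augment_mult_snoc_vec)

text \<open>
  The matrix \<open>[A, b] - [A', b']\<close> maps \<open>(y, -1)\<close> to the negative residual, so its Frobenius norm is at least
  \<open>\<bar>b - A y\<bar> / \<bar>(y, -1)\<bar>\<close>.
\<close>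
lemma tls_objective_le_distance:
  assumes "A' *v y = b'"
  shows "tls_objective A b y \<le> (norm (augment A b - augment A' b'))\<^sup>2"
proof -
  let ?z = "snoc_vec y (-1)"
  have "norm (b - A *v y) = norm ((augment A b - augment A' b') *v ?z)"
    using assms by (simp add: matrix_vector_mult_diff_rdistrib augment_mult_snoc_vec norm_minus_commute)
  also have "\<dots> \<le> norm (augment A b - augment A' b') * norm ?z"
    by (rule norm_matrix_vector_le)
  finally have "(norm (b - A *v y))\<^sup>2 \<le> (norm (augment A b - augment A' b') * norm ?z)\<^sup>2"
    by (rule power_mono) simp
  also have "\<dots> = (norm (augment A b - augment A' b'))\<^sup>2 * (1 + y \<bullet> y)"
    by (simp add: power_mult_distrib power2_norm_eq_inner[of ?z] inner_snoc_vec)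
  finally show ?thesis
    using one_plus_inner_pos[of y] by (simp add: tls_objective_def pos_divide_le_eq)
qed

text \<open>
  Equality holds if the difference of the data is a multiple of \<open>r (y, -1)\<^sup>T\<close> with \<open>r = b - A y\<close>, since the
  estimates by the Frobenius norm are then sharp.
\<close>
lemma tls_objective_distance_attained:
  fixes A :: "real^'n^'m"
  obtains A' b' where "A' *v y = b'" "(norm (augment A b - augment A' b'))\<^sup>2 = tls_objective A b y"
proof -
  define s where "s = 1 + y \<bullet> y"
  have s: "s > 0" "y \<bullet> y = s - 1" using one_plus_inner_pos[of y] by (simp_all add: s_def)
  define r where "r = b - A *v y"
  define A' where "A' = A + (1 / s) *\<^sub>R outer r y"
  define b' where "b' = b - (1 / s) *\<^sub>R r"
  have "A' *v y = A *v y + ((s - 1) / s) *\<^sub>R r"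
    by (simp add: A'_def matrix_vector_mult_add_rdistrib scaleR_matrix_vector_assoc[symmetric] outer_mult s(2))
  also have "(s - 1) / s = 1 - 1 / s" using s(1) by (simp add: field_simps)
  finally have 1: "A' *v y = b'"
    by (simp add: b'_def r_def algebra_simps)
  have "(norm (augment A b - augment A' b'))\<^sup>2 = (norm r * norm y / s)\<^sup>2 + (norm r / s)\<^sup>2"
    using s(1) by (simp add: augment_diff norm_augment A'_def b'_def norm_outer)
  also have "\<dots> = (norm r)\<^sup>2 * (1 + y \<bullet> y) / s\<^sup>2"
    by (simp add: power_divide power_mult_distrib power2_norm_eq_inner add_divide_distrib algebra_simps)
  also have "\<dots> = tls_objective A b y"
    using s(1) by (simp add: tls_objective_def s_def[symmetric] r_def power2_eq_square)
  finally show ?thesis using 1 that by blast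
qed

lemma tls_solution_iff_minimizes_objective:
  "tls_solution A b x \<longleftrightarrow> (\<forall>y. tls_objective A b x \<le> tls_objective A b y)"
proof
  assume "tls_solution A b x"
  then obtain A' b' where min: "tls_minimizer A b A' b'" and x: "A' *v x = b'"
    unfolding tls_solution_def by blast
  show "\<forall>y. tls_objective A b x \<le> tls_objective A b y"
  proof
    fix y
    obtain C d where C: "C *v y = d" "(norm (augment A b - augment C d))\<^sup>2 = tls_objective A b y"
      by (rule tls_objective_distance_attained)
    then have "d \<in> range (\<lambda>y. C *v y)" by blast
    then have "norm (augment A b - augment A' b') \<le> norm (augment A b - augment C d)"
      using min unfolding tls_minimizer_def by blast
    then have "(norm (augment A b - augment A' b'))\<^sup>2 \<le> tls_objective A b y"
      unfolding C(2)[symmetric] by (rule power_mono) simp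
    then show "tls_objective A b x \<le> tls_objective A b y"
      using tls_objective_le_distance[OF x] by (rule order_trans[rotated])
  qed
next
  assume min: "\<forall>y. tls_objective A b x \<le> tls_objective A b y"
  obtain A' b' where A': "A' *v x = b'" "(norm (augment A b - augment A' b'))\<^sup>2 = tls_objective A b x"
    by (rule tls_objective_distance_attained)
  have "norm (augment A b - augment A' b') \<le> norm (augment A b - augment C d)"
    if d: "d \<in> range (\<lambda>y. C *v y)" for C d
  proof -
    obtain y where "C *v y = d" using d by blast
    then have "(norm (augment A b - augment A' b'))\<^sup>2 \<le> (norm (augment A b - augment C d))\<^sup>2"
      using min A'(2) tls_objective_le_distance order_trans by metis
    then show ?thesis by (rule power2_le_imp_le) simp
  qed
  then have "tls_minimizer A b A' b'"
    unfolding tls_minimizer_def using A'(1) by blast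
  then show "tls_solution A b x" unfolding tls_solution_def using A'(1) by blast
qed

text \<open>
  This is the matrix \<open>P\<close> of the main result.
\<close>
definition tls_gram :: "real^'n^'m \<Rightarrow> real^'m \<Rightarrow> real^'n^'n" where
  "tls_gram A b = transpose A ** A - (sigma_min (augment A b))\<^sup>2 *\<^sub>R mat 1"

lemma tls_gram_mult:
  "tls_gram A b *v y = (A *v y) v* A - (sigma_min (augment A b))\<^sup>2 *\<^sub>R y"
  by (simp add: tls_gram_def matrix_vector_mult_diff_rdistrib scaleR_matrix_vector_assoc[symmetric]
      matrix_vector_mul_assoc[symmetric])

context
  fixes A :: "real^'n^'m" and b :: "real^'m"
  assumes card: "CARD('n) < CARD('m)"
begin

lemma sigma_min_augment_le_objective: "(sigma_min (augment A b))\<^sup>2 \<le> tls_objective A b y"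
proof -
  have card': "CARD('n + 1) \<le> CARD('m)" using card by simp
  let ?\<sigma> = "sigma_min (augment A b)" and ?z = "snoc_vec y (-1)"
  obtain v :: "real^('n + 1)" where v: "norm (augment A b *v v) = ?\<sigma>"
    and low: "\<And>w. ?\<sigma> * norm w \<le> norm (augment A b *v w)"
    using sigma_min_attained[OF card', of "augment A b"] by metis
  have "0 \<le> ?\<sigma>" by (simp flip: v)
  then have "(?\<sigma> * norm ?z)\<^sup>2 \<le> (norm (augment A b *v ?z))\<^sup>2"
    using low by (intro power_mono) auto
  then have "?\<sigma>\<^sup>2 * (1 + y \<bullet> y) \<le> (norm (b - A *v y))\<^sup>2"
    unfolding augment_mult_minus_one norm_minus_cancel power_mult_distrib power2_norm_eq_inner[of ?z]
    by (simp add: inner_snoc_vec add.commute)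
  then show ?thesis
    using one_plus_inner_pos[of y] by (simp add: tls_objective_def pos_le_divide_eq)
qed

lemma sigma_min_nonneg: "0 \<le> sigma_min A" "0 \<le> sigma_min (augment A b)"
proof -
  show "0 \<le> sigma_min A"
    using sigma_min_attained[of A] card by (metis less_imp_le norm_ge_zero)
  have "CARD('n + 1) \<le> CARD('m)" using card by simp
  then show "0 \<le> sigma_min (augment A b)"
    using sigma_min_attained[of "augment A b"] by (metis norm_ge_zero)
qed

lemma sigma_min_lower: "(sigma_min A)\<^sup>2 * (y \<bullet> y) \<le> (A *v y) \<bullet> (A *v y)"
proof -
  have "sigma_min A * norm y \<le> norm (A *v y)"
    using sigma_min_attained[of A] card by (metis less_imp_le)
  then have "(sigma_min A * norm y)\<^sup>2 \<le> (norm (A *v y))\<^sup>2"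
    using sigma_min_nonneg by (intro power_mono) auto
  then show ?thesis by (simp add: power_mult_distrib power2_norm_eq_inner)
qed

text \<open>
  The quantitative form of genericity: the gap between the squared least singular values bounds \<open>P\<close> from
  below. It gives invertibility at the data and a uniform bound near them.
\<close>
lemma tls_gram_coercive:
  "((sigma_min A)\<^sup>2 - (sigma_min (augment A b))\<^sup>2) * (y \<bullet> y) \<le> (tls_gram A b *v y) \<bullet> y"
  using sigma_min_lower[of y]
  by (simp add: tls_gram_mult inner_diff_left dot_lmul_matrix algebra_simps)

context
  assumes generic: "tls_generic A b"
begin

lemma spectral_gap_pos: "0 < (sigma_min A)\<^sup>2 - (sigma_min (augment A b))\<^sup>2"
  using generic sigma_min_nonneg unfolding tls_generic_def
  by (simp add: power_strict_mono)

lemma invertible_tls_gram: "invertible (tls_gram A b)"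
proof -
  have "y = 0" if "tls_gram A b *v y = 0" for y
    using tls_gram_coercive[of y] spectral_gap_pos that
    by (metis inner_zero_left inner_gt_zero_iff mult_pos_pos not_le)
  then show ?thesis
    by (simp add: invertible_left_inverse matrix_left_invertible_ker)
qed

text \<open>
  A minimal right singular vector \<open>(y, c)\<close> of \<open>[A, b]\<close> has \<open>c \<noteq> 0\<close>: otherwise \<open>\<bar>A y\<bar>\<close> would equal the least
  singular value of \<open>[A, b]\<close>, which is below that of \<open>A\<close>. Rescaling the vector to \<open>(x, -1)\<close> gives
  the minimizer.
\<close>
lemma ex_objective_eq_sigma_min:
  "\<exists>x. tls_objective A b x = (sigma_min (augment A b))\<^sup>2"
proof -
  have card': "CARD('n + 1) \<le> CARD('m)" using card by simp
  let ?\<sigma> = "sigma_min (augment A b)"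
  obtain v where v: "norm v = 1" "norm (augment A b *v v) = ?\<sigma>"
    by (rule sigma_min_attained[OF card'])
  obtain y c where vy: "v = snoc_vec y c" by (rule snoc_vec_cases)
  have yc: "y \<bullet> y + c * c = 1"
    using v(1) by (simp add: vy norm_eq_1 inner_snoc_vec)
  have M: "(norm (A *v y + c *\<^sub>R b))\<^sup>2 = ?\<sigma>\<^sup>2"
    using v(2) by (simp add: vy augment_mult_snoc_vec)
  have c: "c \<noteq> 0"
  proof
    assume "c = 0"
    then show False
      using M yc sigma_min_lower[of y] spectral_gap_pos by (simp add: power2_norm_eq_inner)
  qed
  define x where "x = (- 1 / c) *\<^sub>R y"
  have "A *v x = (- 1 / c) *\<^sub>R (A *v y)"
    by (simp only: x_def matrix_vector_mult_scaleR)
  then have "b - A *v x = (1 / c) *\<^sub>R (A *v y + c *\<^sub>R b)"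
    using c by (simp add: scaleR_add_right)
  then have r: "(norm (b - A *v x))\<^sup>2 = ?\<sigma>\<^sup>2 / c\<^sup>2"
    using M by (simp add: power_mult_distrib power_divide)
  have "1 + x \<bullet> x = 1 / c\<^sup>2"
    using c yc by (simp add: x_def field_simps power2_eq_square)
  then have "tls_objective A b x = ?\<sigma>\<^sup>2"
    using r c by (simp add: tls_objective_def)
  then show ?thesis by blast
qed

lemma tls_solution_iff_objective:
  "tls_solution A b x \<longleftrightarrow> tls_objective A b x = (sigma_min (augment A b))\<^sup>2"
  using ex_objective_eq_sigma_min sigma_min_augment_le_objective
  unfolding tls_solution_iff_minimizes_objective by (metis order_antisym)

lemma tls_solution_residual:
  assumes "tls_solution A b x"
  shows "(b - A *v x) \<bullet> (b - A *v x) = (sigma_min (augment A b))\<^sup>2 * (1 + x \<bullet> x)"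
  using assms one_plus_inner_pos[of x] unfolding tls_solution_iff_objective tls_objective_def
  by (simp add: power2_norm_eq_inner divide_eq_eq)

text \<open>
  The vector \<open>(x, -1)\<close> is a least eigenvector of \<open>[A, b]\<^sup>T [A, b]\<close>; the claim is the first block of the
  eigenvector equation.
\<close>
lemma tls_solution_stationary:
  assumes x: "tls_solution A b x"
  shows "(b - A *v x) v* A = - ((sigma_min (augment A b))\<^sup>2 *\<^sub>R x)"
proof -
  let ?\<mu> = "(sigma_min (augment A b))\<^sup>2" and ?M = "augment A b" and ?z = "snoc_vec x (-1)"
  have card': "CARD('n + 1) \<le> CARD('m)" using card by simp
  have eig: "transpose ?M *v (?M *v ?z) = ?\<mu> *\<^sub>R ?z"
  proof (rule least_stretch_eigenvector)
    fix w
    have "sigma_min ?M * norm w \<le> norm (?M *v w)"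
      using sigma_min_attained[OF card', of ?M] by metis
    then have "(sigma_min ?M * norm w)\<^sup>2 \<le> (norm (?M *v w))\<^sup>2"
      using sigma_min_nonneg by (intro power_mono) auto
    then show "?\<mu> * (w \<bullet> w) \<le> (?M *v w) \<bullet> (?M *v w)"
      by (simp add: power_mult_distrib power2_norm_eq_inner)
  next
    show "(?M *v ?z) \<bullet> (?M *v ?z) = ?\<mu> * (?z \<bullet> ?z)"
      unfolding augment_mult_minus_one inner_snoc_vec using tls_solution_residual[OF x]
      by (simp add: algebra_simps)
  qed
  have "((b - A *v x) v* A + ?\<mu> *\<^sub>R x) \<bullet> h = 0" for h
  proof -
    have "?\<mu> * (x \<bullet> h) = (transpose ?M *v (?M *v ?z)) \<bullet> snoc_vec h 0"
      unfolding eig by (simp add: inner_snoc_vec)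
    also have "\<dots> = (?M *v ?z) \<bullet> (?M *v snoc_vec h 0)"
      by (simp add: dot_lmul_matrix)
    also have "\<dots> = - ((b - A *v x) \<bullet> (A *v h))"
      unfolding augment_mult_minus_one by (simp add: augment_mult_snoc_vec inner_diff_left)
    finally have "?\<mu> * (x \<bullet> h) = - ((b - A *v x) \<bullet> (A *v h))" .
    then show ?thesis by (simp add: inner_add_left dot_lmul_matrix)
  qed
  then have "(b - A *v x) v* A + ?\<mu> *\<^sub>R x = 0"
    using inner_eq_zero_iff by blast
  then show ?thesis by (simp add: eq_neg_iff_add_eq_0)
qed

lemma tls_solution_normal_equation:
  assumes "tls_solution A b x"
  shows "tls_gram A b *v x = b v* A"
proof -
  have "(b - A *v x) v* A = b v* A - (A *v x) v* A"
    using matrix_vector_mult_diff_distrib[of "transpose A" b "A *v x"] by simp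
  then show ?thesis
    using tls_solution_stationary[OF assms] unfolding tls_gram_mult by (simp add: algebra_simps)
qed

lemma tls_solution_unique: "\<exists>!x. tls_solution A b x"
proof (rule ex_ex1I)
  show "\<exists>x. tls_solution A b x"
    using ex_objective_eq_sigma_min tls_solution_iff_objective by blast
next
  fix x y assume "tls_solution A b x" "tls_solution A b y"
  then have "tls_gram A b *v x = tls_gram A b *v y"
    by (simp add: tls_solution_normal_equation)
  then show "x = y"
    using inj_matrix_vector_mult[OF invertible_tls_gram] by (meson injD)
qed

end
end

section \<open>Differentiating the solution with respect to the data\<close>

text \<open>
  A continuous solution branch of \<open>F (d, X d) = 0\<close> inherits differentiability at any point where the partial
  derivative of \<open>F\<close> in the second argument has a bounded left inverse \<open>Q\<close>. Continuity makes the expansion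
  of \<open>F\<close> applicable along the branch; it bounds the increment of \<open>X\<close> by a multiple of that of \<open>d\<close>, after
  which the same expansion gives the derivative.
\<close>
lemma implicit_has_derivative:
  fixes F :: "'a::real_normed_vector \<times> 'b::real_normed_vector \<Rightarrow> 'c::real_normed_vector"
  assumes F: "(F has_derivative F') (at (d, X d))"
    and Q: "bounded_linear Q" "\<And>h. Q (F' (0, h)) = h"
    and cont: "isCont X d"
    and zero: "eventually (\<lambda>e. F (e, X e) = 0) (nhds d)"
  shows "(X has_derivative (\<lambda>e. - Q (F' (e, 0)))) (at d)"
proof -
  interpret Q: bounded_linear Q by fact
  interpret F': bounded_linear F' using F by (rule has_derivative_bounded_linear)
  let ?T = "\<lambda>e. - Q (F' (e, 0))"
  have blT: "bounded_linear ?T"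
    by (intro bounded_linear_minus bounded_linear_compose[OF Q(1)]
        bounded_linear_compose[OF F'.bounded_linear_axioms] bounded_linear_Pair
        bounded_linear_ident bounded_linear_zero)
  obtain K where K: "0 < K" "\<And>z. norm (Q z) \<le> norm z * K"
    using Q.pos_bounded by blast
  obtain C where C: "0 < C" "\<And>e. norm (?T e) \<le> norm e * C"
    using bounded_linear.pos_bounded[OF blT] by blast
  have F0: "F (d, X d) = 0" using zero by (rule eventually_nhds_x_imp_x)
  show ?thesis
    unfolding has_derivative_at_alt
  proof (intro conjI blT allI impI)
    fix \<epsilon> :: real assume \<epsilon>: "0 < \<epsilon>"
    \<comment> \<open>Half absorbs the increment of \<open>X\<close> on the right; the other bound turns the result into \<open>\<epsilon>\<close>.\<close>
    define \<theta> where "\<theta> = min (1/2) (\<epsilon> / (2 * C + 2))"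
    have \<theta>: "0 < \<theta>" "\<theta> \<le> 1/2" "\<theta> \<le> \<epsilon> / (2 * C + 2)"
      unfolding \<theta>_def using \<epsilon> C(1) by (simp_all only: min.cobounded1 min.cobounded2) auto
    have "0 < \<theta> / K" using \<theta> K by simp
    then obtain \<rho> where \<rho>: "0 < \<rho>"
      and err: "\<And>y. norm (y - (d, X d)) < \<rho> \<Longrightarrow>
        norm (F y - F (d, X d) - F' (y - (d, X d))) \<le> \<theta> / K * norm (y - (d, X d))"
      using F unfolding has_derivative_at_alt by blast
    have "((\<lambda>e. (e, X e)) \<longlongrightarrow> (d, X d)) (nhds d)"
      using cont by (intro tendsto_Pair filterlim_ident)
        (simp add: isCont_def tendsto_at_iff_tendsto_nhds[of X d])
    then have "eventually (\<lambda>e. dist (e, X e) (d, X d) < \<rho>) (nhds d)"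
      using \<rho> by (rule tendstoD)
    with zero have "eventually (\<lambda>e. F (e, X e) = 0 \<and> dist (e, X e) (d, X d) < \<rho>) (nhds d)"
      by (rule eventually_conj)
    then obtain \<delta> where \<delta>: "0 < \<delta>"
      and near: "\<And>e. dist e d < \<delta> \<Longrightarrow> F (e, X e) = 0 \<and> dist (e, X e) (d, X d) < \<rho>"
      unfolding eventually_nhds_metric by blast
    have "norm (X e - X d - ?T (e - d)) \<le> \<epsilon> * norm (e - d)" if e: "norm (e - d) < \<delta>" for e
    proof -
      let ?h = "X e - X d" and ?k = "e - d"
      have Fe: "F (e, X e) = 0" and close: "norm ((e, X e) - (d, X d)) < \<rho>"
        using near[of e] e by (auto simp: dist_norm)
      have split: "F' (?k, ?h) = F' (?k, 0) + F' (0, ?h)"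
        by (simp flip: F'.add)
      have "norm (?h - ?T ?k) = norm (Q (F' (?k, ?h)))"
        by (simp add: split Q.add Q(2) add.commute)
      also have "\<dots> \<le> norm (F' (?k, ?h)) * K" by (rule K)
      also have "\<dots> \<le> \<theta> / K * norm (?k, ?h) * K"
        using err[OF close] K(1) by (intro mult_right_mono) (auto simp: Fe F0)
      also have "\<dots> = \<theta> * norm (?k, ?h)" using K(1) by simp
      also have "\<dots> \<le> \<theta> * (norm ?k + norm ?h)"
        using \<theta>(1) by (intro mult_left_mono norm_Pair_le) auto
      finally have main: "norm (?h - ?T ?k) \<le> \<theta> * (norm ?k + norm ?h)" .
      have "norm ?h \<le> norm (?h - ?T ?k) + norm (?T ?k)"
        using norm_triangle_ineq[of "?h - ?T ?k" "?T ?k"] by simp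
      also have "\<dots> \<le> 1/2 * (norm ?k + norm ?h) + norm ?k * C"
        using main C(2)[of ?k] mult_right_mono[OF \<theta>(2) add_nonneg_nonneg[OF norm_ge_zero norm_ge_zero],
            of ?k ?h] by linarith
      finally have "norm ?h \<le> (2 * C + 1) * norm ?k" by (simp add: algebra_simps)
      then have "norm ?k + norm ?h \<le> (2 * C + 2) * norm ?k" by (simp add: algebra_simps)
      then have "\<theta> * (norm ?k + norm ?h) \<le> \<epsilon> / (2 * C + 2) * ((2 * C + 2) * norm ?k)"
        using \<theta> \<epsilon> C(1) by (intro mult_mono) auto
      then show ?thesis using main C(1) by simp
    qed
    then show "\<exists>\<delta>>0. \<forall>e. norm (e - d) < \<delta> \<longrightarrow> norm (X e - X d - ?T (e - d)) \<le> \<epsilon> * norm (e - d)"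
      using \<delta> by blast
  qed
qed

lemma bounded_bilinear_matrix_vector: "bounded_bilinear (\<lambda>(A::real^'n^'m) v. A *v v)"
  unfolding bilinear_conv_bounded_bilinear[symmetric] bilinear_def
  by (auto intro!: linearI simp: matrix_vector_mult_add_rdistrib matrix_vector_right_distrib
      matrix_vector_mult_scaleR scaleR_matrix_vector_assoc[symmetric])

lemma bounded_bilinear_vector_matrix: "bounded_bilinear (\<lambda>v (A::real^'n^'m). v v* A)"
  unfolding bilinear_conv_bounded_bilinear[symmetric] bilinear_def
  by (auto intro!: linearI simp: vector_matrix_mult_def vec_eq_iff algebra_simps sum.distrib sum_distrib_left)

lemmas matrix_vector_has_derivative [derivative_intros] =
  bounded_bilinear.FDERIV[OF bounded_bilinear_matrix_vector]
lemmas matrix_vector_continuous [continuous_intros] =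
  bounded_bilinear.continuous[OF bounded_bilinear_matrix_vector]
lemmas vector_matrix_continuous [continuous_intros] =
  bounded_bilinear.continuous[OF bounded_bilinear_vector_matrix]

lemma isCont_augment: "isCont (\<lambda>D. augment (fst D) (snd D)) (D :: (real^'n^'m) \<times> (real^'m))"
proof (rule linear_continuous_at, rule linear_conv_bounded_linear[THEN iffD1], rule linearI)
  show "augment (fst (D + E)) (snd (D + E)) = augment (fst D) (snd D) + augment (fst E) (snd E)"
    for D E :: "(real^'n^'m) \<times> (real^'m)"
    by (auto simp: vec_eq_iff augment_def hcat_def columnvector_def split: sum.split)
  show "augment (fst (c *\<^sub>R D)) (snd (c *\<^sub>R D)) = c *\<^sub>R augment (fst D) (snd D)"
    for c and D :: "(real^'n^'m) \<times> (real^'m)"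
    by (auto simp: vec_eq_iff augment_def hcat_def columnvector_def split: sum.split)
qed

lemma isCont_sigma_min:
  assumes "CARD('n) \<le> CARD('m)"
  shows "isCont (sigma_min :: real^'n^'m \<Rightarrow> real) M"
  using continuous_on_sigma_min[OF assms, of UNIV] by (simp add: continuous_on_eq_continuous_at)

definition tls_point :: "(real^'n^'m) \<times> (real^'m) \<Rightarrow> real^'n" where
  "tls_point D = (THE x. tls_solution (fst D) (snd D) x)"

text \<open>
  Up to a positive factor this is the negative gradient of the TLS objective in \<open>x\<close>. Unlike \<open>P x - A\<^sup>T b\<close> it
  does not involve the least singular value, so it is differentiable by the elementary rules.
\<close>
definition tls_gradient :: "((real^'n^'m) \<times> (real^'m)) \<times> (real^'n) \<Rightarrow> real^'n" where
  "tls_gradient = (\<lambda>((A, b), x). (b - A *v x) v* A +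
     (((b - A *v x) \<bullet> (b - A *v x)) / (1 + x \<bullet> x)) *\<^sub>R x)"

lemma tls_point_solution:
  fixes D :: "(real^'n^'m) \<times> (real^'m)"
  assumes "CARD('n) < CARD('m)" "tls_generic (fst D) (snd D)"
  shows "tls_solution (fst D) (snd D) (tls_point D)"
  unfolding tls_point_def by (rule theI'[OF tls_solution_unique[OF assms]])

context
  fixes D :: "(real^'n^'m) \<times> (real^'m)"
  assumes card: "CARD('n) < CARD('m)" and generic: "tls_generic (fst D) (snd D)"
begin

lemma isCont_sigma_min_data: "isCont (\<lambda>E. sigma_min (fst E)) D"
  "isCont (\<lambda>E. sigma_min (augment (fst E) (snd E))) D"
proof -
  have "CARD('n + 1) \<le> CARD('m)" using card by simp
  then show "isCont (\<lambda>E. sigma_min (augment (fst E) (snd E))) D"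
    by (intro isCont_o2[OF isCont_augment] isCont_sigma_min)
  show "isCont (\<lambda>E. sigma_min (fst E)) D"
    using card by (intro isCont_o2[OF _ isCont_sigma_min] continuous_intros) auto
qed

lemma eventually_generic: "eventually (\<lambda>E. tls_generic (fst E) (snd E)) (nhds D)"
proof -
  have "isCont (\<lambda>E. sigma_min (fst E) - sigma_min (augment (fst E) (snd E))) D"
    by (intro continuous_intros isCont_sigma_min_data)
  moreover have "0 < sigma_min (fst D) - sigma_min (augment (fst D) (snd D))"
    using generic by (simp add: tls_generic_def)
  ultimately have "eventually (\<lambda>E. 0 < sigma_min (fst E) - sigma_min (augment (fst E) (snd E))) (at D)"
    unfolding isCont_def by (rule order_tendstoD)
  then show ?thesis
    using generic by (simp add: tls_generic_def eventually_nhds_conv_at)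
qed

text \<open>
  Let \<open>P\<close> belong to neighbouring data. Subtracting \<open>P x\<close>, with the unperturbed solution \<open>x\<close>, from the normal
  equation for the neighbouring data and using the coercivity of \<open>P\<close> bounds the change of the solution
  by a residual that tends to zero, divided by a gap that stays away from zero.
\<close>
lemma isCont_tls_point: "isCont tls_point D"
proof -
  let ?gap = "\<lambda>E :: (real^'n^'m) \<times> (real^'m).
    (sigma_min (fst E))\<^sup>2 - (sigma_min (augment (fst E) (snd E)))\<^sup>2"
  let ?x = "tls_point D"
  let ?res = "\<lambda>E. snd E v* fst E - tls_gram (fst E) (snd E) *v ?x"
  have bound: "norm (tls_point E - ?x) \<le> norm (?res E) / ?gap E"
    if E: "tls_generic (fst E) (snd E)" for E
  proof -
    let ?h = "tls_point E - ?x"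
    have gap: "0 < ?gap E" by (rule spectral_gap_pos[OF card E])
    have "?gap E * (norm ?h)\<^sup>2 \<le> (tls_gram (fst E) (snd E) *v ?h) \<bullet> ?h"
      using tls_gram_coercive[OF card] by (simp add: power2_norm_eq_inner)
    also have "tls_gram (fst E) (snd E) *v ?h = ?res E"
      using tls_solution_normal_equation[OF card E tls_point_solution[OF card E]]
      by (simp add: matrix_vector_mult_diff_distrib)
    also have "?res E \<bullet> ?h \<le> norm (?res E) * norm ?h"
      by (rule norm_cauchy_schwarz)
    finally have "?gap E * norm ?h * norm ?h \<le> norm (?res E) * norm ?h"
      by (simp add: power2_eq_square mult.assoc)
    then have "?gap E * norm ?h \<le> norm (?res E)"
      by (cases "?h = 0") auto
    then show ?thesis using gap by (simp add: pos_le_divide_eq mult.commute)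
  qed
  have "isCont (\<lambda>E. norm (?res E) / ?gap E) D"
    unfolding tls_gram_mult using spectral_gap_pos[OF card generic]
    by (intro continuous_intros isCont_sigma_min_data) auto
  moreover have "?res D = 0"
    using tls_solution_normal_equation[OF card generic tls_point_solution[OF card generic]] by simp
  ultimately have lim: "((\<lambda>E. norm (?res E) / ?gap E) \<longlongrightarrow> 0) (at D)"
    by (simp add: isCont_def)
  have "eventually (\<lambda>E. tls_generic (fst E) (snd E)) (at D)"
    using eventually_generic by (simp add: eventually_nhds_conv_at)
  then have "eventually (\<lambda>E. norm (tls_point E - ?x) \<le> norm (?res E) / ?gap E) (at D)"
    by eventually_elim (rule bound)
  then have "((\<lambda>E. tls_point E - ?x) \<longlongrightarrow> 0) (at D)"
    using lim by (rule Lim_null_comparison)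
  then show ?thesis unfolding isCont_def by (rule LIM_zero_cancel)
qed

end

text \<open>
  The two assumptions hold at a solution. They cancel the contribution of \<open>h\<close> to the derivative of the
  quotient, because the quotient is stationary in \<open>x\<close> there; what remains of \<open>h\<close> is \<open>- P h\<close>.
\<close>
lemma tls_gradient_has_derivative:
  fixes A :: "real^'n^'m"
  assumes stat: "(b - A *v x) v* A = - (\<mu> *\<^sub>R x)"
    and res: "(b - A *v x) \<bullet> (b - A *v x) = \<mu> * (1 + x \<bullet> x)"
  shows "(tls_gradient has_derivative (\<lambda>((dA, db), h).
      (db - dA *v x) v* A + (b - A *v x) v* dA
      + (2 * ((b - A *v x) \<bullet> (db - dA *v x)) / (1 + x \<bullet> x)) *\<^sub>R x
      - ((A *v h) v* A - \<mu> *\<^sub>R h))) (at ((A, b), x))"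
proof -
  define r where "r = b - A *v x"
  define s where "s = 1 + x \<bullet> x"
  have s: "s \<noteq> 0" using one_plus_inner_pos[of x] by (simp add: s_def)
  let ?res = "\<lambda>p. snd (fst p) - fst (fst p) *v snd p" and ?z = "((A, b), x)"
  let ?dr = "\<lambda>q. snd (fst q) - (A *v snd q + fst (fst q) *v x)"
  have rAh: "r \<bullet> (A *v h) = - \<mu> * (x \<bullet> h)" for h
    unfolding dot_lmul_matrix[symmetric] r_def stat by simp
  have dres: "(?res has_derivative ?dr) (at ?z)"
    by (auto intro!: derivative_eq_intros)
  have dnum: "((\<lambda>p. ?res p \<bullet> ?res p) has_derivative (\<lambda>q. 2 * (r \<bullet> ?dr q))) (at ?z)"
    using has_derivative_inner[OF dres dres] by (simp add: r_def inner_commute)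
  have dden: "((\<lambda>p. 1 + snd p \<bullet> snd p) has_derivative (\<lambda>q. 2 * (x \<bullet> snd q))) (at ?z)"
    by (auto intro!: derivative_eq_intros simp: inner_commute)
  \<comment> \<open>The \<open>h\<close>-terms cancel: stationarity turns \<open>r \<bullet> A h\<close> into \<open>- \<mu> (x \<bullet> h)\<close>, and \<open>r \<bullet> r = \<mu> s\<close>.\<close>
  have quot: "(2 * (r \<bullet> (w - A *v h)) * s - (r \<bullet> r) * (2 * (x \<bullet> h))) / (s * s) = 2 * (r \<bullet> w) / s"
    for w h
    using s res unfolding inner_diff_right rAh r_def[symmetric] s_def[symmetric]
    by (simp add: field_simps)
  have dquot: "((\<lambda>p. (?res p \<bullet> ?res p) / (1 + snd p \<bullet> snd p)) has_derivative
      (\<lambda>q. 2 * (r \<bullet> (snd (fst q) - fst (fst q) *v x)) / s)) (at ?z)"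
    using has_derivative_divide'[OF dnum dden] s quot[of "snd (fst q) - fst (fst q) *v x" "snd q" for q]
    by (simp add: s_def r_def diff_diff_eq add.commute)
  have dgrad: "((\<lambda>p. ?res p v* fst (fst p) + ((?res p \<bullet> ?res p) / (1 + snd p \<bullet> snd p)) *\<^sub>R snd p)
      has_derivative (\<lambda>q. (r v* fst (fst q) + ?dr q v* A) + (\<mu> *\<^sub>R snd q +
        (2 * (r \<bullet> (snd (fst q) - fst (fst q) *v x)) / s) *\<^sub>R x))) (at ?z)"
    using has_derivative_add[OF
        bounded_bilinear.FDERIV[OF bounded_bilinear_vector_matrix dres
          has_derivative_fst[OF has_derivative_fst[OF has_derivative_ident]]]
        has_derivative_scaleR[OF dquot has_derivative_snd[OF has_derivative_ident]]] s res
    by (simp add: r_def s_def)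
  show ?thesis
    using dgrad unfolding tls_gradient_def case_prod_beta r_def s_def
    by (simp add: bounded_bilinear.diff_left[OF bounded_bilinear_vector_matrix]
        bounded_bilinear.add_left[OF bounded_bilinear_vector_matrix] algebra_simps)
qed

lemma matrix_inv_mult_vec:
  fixes P :: "real^'n^'n"
  assumes "invertible P"
  shows "matrix_inv P *v (P *v y) = y"
proof -
  have "matrix_inv P ** P = mat 1"
    using someI_ex[OF assms[unfolded invertible_def]] by (simp add: matrix_inv_def)
  then show ?thesis by (simp add: matrix_vector_mul_assoc)
qed

lemma tls_point_has_derivative:
  fixes A :: "real^'n^'m"
  assumes card: "CARD('n) < CARD('m)" and generic: "tls_generic A b" and x: "tls_solution A b x"
  shows "(tls_point has_derivative (\<lambda>(dA, db). matrix_inv (tls_gram A b) *v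
      ((db - dA *v x) v* A + (b - A *v x) v* dA
       + (2 * ((b - A *v x) \<bullet> (db - dA *v x)) / (1 + x \<bullet> x)) *\<^sub>R x))) (at (A, b))"
proof -
  let ?P = "tls_gram A b" and ?\<mu> = "(sigma_min (augment A b))\<^sup>2"
  have generic': "tls_generic (fst (A, b)) (snd (A, b))" using generic by simp
  have pt: "tls_point (A, b) = x"
    using tls_solution_unique[OF card generic] x by (auto simp: tls_point_def)
  let ?F' = "\<lambda>((dA, db), h). (db - dA *v x) v* A + (b - A *v x) v* dA
      + (2 * ((b - A *v x) \<bullet> (db - dA *v x)) / (1 + x \<bullet> x)) *\<^sub>R x
      - ((A *v h) v* A - ?\<mu> *\<^sub>R h)"
  have "(tls_point has_derivative (\<lambda>E. - (- (matrix_inv ?P *v ?F' (E, 0))))) (at (A, b))"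
  proof (rule implicit_has_derivative[where F = tls_gradient and Q = "\<lambda>y. - (matrix_inv ?P *v y)"])
    show "(tls_gradient has_derivative ?F') (at ((A, b), tls_point (A, b)))"
      unfolding pt
      by (rule tls_gradient_has_derivative[OF tls_solution_stationary tls_solution_residual])
        (use card generic x in auto)
    show "bounded_linear (\<lambda>y. - (matrix_inv ?P *v y))"
      by (intro bounded_linear_minus matrix_vector_mul_bounded_linear)
    show "- (matrix_inv ?P *v ?F' (0, h)) = h" for h
    proof -
      have "?F' (0, h) = (-1) *\<^sub>R (?P *v h)"
        by (simp add: zero_prod_def tls_gram_mult)
      then show ?thesis
        using matrix_inv_mult_vec[OF invertible_tls_gram[OF card generic]]
        by (simp only: matrix_vector_mult_scaleR) simp
    qed
    show "isCont tls_point (A, b)" by (rule isCont_tls_point[OF card generic'])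
    show "eventually (\<lambda>E. tls_gradient (E, tls_point E) = 0) (nhds (A, b))"
      using eventually_generic[OF card generic']
    proof eventually_elim
      case (elim E)
      note sol = tls_point_solution[OF card elim]
      show ?case
        using tls_solution_stationary[OF card elim sol] tls_solution_residual[OF card elim sol]
          one_plus_inner_pos[of "tls_point E"]
        by (simp add: tls_gradient_def case_prod_beta)
    qed
  qed
  then show ?thesis by (simp add: case_prod_unfold)
qed

section \<open>The componentwise condition number\<close>

lemma hcat_mult: "hcat X Y *v t = X *v (\<chi> i. t $ Inl i) + Y *v (\<chi> j. t $ Inr j)"
  by (simp add: vec_eq_iff matrix_vector_mult_def hcat_def sum_UNIV_sum)

lemma diag_mat_mult: "diag_mat d *v t = (\<chi> i. d $ i * t $ i)"
  by (simp add: vec_eq_iff matrix_vector_mult_def diag_mat_def if_distrib[of "\<lambda>c. c * _"] cong: if_cong)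

lemma sum_UNIV_prod:
  fixes f :: "'a::finite \<times> 'b::finite \<Rightarrow> 'c::comm_monoid_add"
  shows "(\<Sum>p\<in>UNIV. f p) = (\<Sum>i\<in>UNIV. \<Sum>j\<in>UNIV. f (i, j))"
  by (simp add: sum.cartesian_product flip: UNIV_Times_UNIV)

text \<open>
  The instance \<open>vec (G X x) = (x\<^sup>T \<otimes> G) vec X\<close> of the vectorization identity.
\<close>
lemma kron_row_mult_vec_cols:
  "drop_fst_row (kron (rowvector x :: real^'n^1) G) *v vec_cols dA = G *v (dA *v x)"
  unfolding vec_eq_iff
proof
  fix i
  have "(drop_fst_row (kron (rowvector x :: real^'n^1) G) *v vec_cols dA) $ i
      = (\<Sum>j\<in>UNIV. \<Sum>l\<in>UNIV. x $ j * G $ i $ l * dA $ l $ j)"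
    by (simp add: matrix_vector_mult_def drop_fst_row_def kron_def vec_cols_def rowvector_def sum_UNIV_prod)
  also have "\<dots> = (\<Sum>l\<in>UNIV. \<Sum>j\<in>UNIV. G $ i $ l * (dA $ l $ j * x $ j))"
    by (subst sum.swap) (simp add: algebra_simps)
  also have "\<dots> = (G *v (dA *v x)) $ i"
    by (simp add: matrix_vector_mult_def sum_distrib_left)
  finally show "(drop_fst_row (kron (rowvector x :: real^'n^1) G) *v vec_cols dA) $ i
      = (G *v (dA *v x)) $ i" .
qed

text \<open>
  The instance \<open>vec (r\<^sup>T X) = (I \<otimes> r\<^sup>T) vec X\<close> of the vectorization identity.
\<close>
lemma kron_mat_1_mult_vec_cols:
  "drop_snd_row (kron (mat 1 :: real^'n^'n) (rowvector r :: real^'m^1)) *v vec_cols dA = r v* dA"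
proof -
  have "(\<Sum>j\<in>UNIV. \<Sum>l\<in>UNIV. (if i = j then 1 else 0) * r $ l * dA $ l $ j) = (\<Sum>l\<in>UNIV. r $ l * dA $ l $ i)"
    for i
    by (subst sum.swap) (simp add: mult.assoc if_distrib[of "\<lambda>c. c * _"] cong: if_cong)
  then show ?thesis
    by (simp add: vec_eq_iff vector_matrix_mult_def matrix_vector_mult_def drop_snd_row_def kron_def mat_def
        vec_cols_def rowvector_def sum_UNIV_prod mult.commute)
qed

text \<open>
  The factors are indexed like the columns of \<open>[N D\<^sub>A, H D\<^sub>b]\<close>, so that this matrix can be applied to them.
\<close>
definition scale_data ::
  "real^(('n \<times> 'm) + 'm) \<Rightarrow> (real^'n^'m) \<times> (real^'m) \<Rightarrow> (real^'n^'m) \<times> (real^'m)" where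
  "scale_data t = (\<lambda>(A, b). (\<chi> i j. A $ i $ j * t $ Inl (j, i), \<chi> i. b $ i * t $ Inr i))"

lemma hcat_diag_mult_scale_data:
  assumes "scale_data t (A, b) = (dA, db)"
  shows "hcat (N ** diag_mat (vec_cols A)) (H ** diag_mat b) *v t = N *v vec_cols dA + H *v db"
  using assms
  by (auto simp: hcat_mult diag_mat_mult vec_cols_def scale_data_def matrix_vector_mul_assoc[symmetric])

lemma comp_bound_scale_data:
  assumes "\<And>i. \<bar>t $ i\<bar> \<le> 1"
  shows "comp_bound D (scale_data t D) 1"
  using assms by (auto simp: comp_bound_def scale_data_def case_prod_beta abs_mult mult_left_le)

text \<open>
  The factors are the entrywise quotients. Where the data vanish, so does the perturbation, and
  division by zero yields the harmless factor \<open>0\<close>.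
\<close>
lemma comp_bound_1_scale_data:
  fixes D E :: "(real^'n^'m) \<times> (real^'m)"
  assumes "comp_bound D E 1"
  obtains t where "\<And>i. \<bar>t $ i\<bar> \<le> 1" "scale_data t D = E"
proof -
  obtain A b dA db where DE: "D = (A, b)" "E = (dA, db)" by (meson surj_pair)
  have le: "\<bar>dA $ i $ j\<bar> \<le> \<bar>A $ i $ j\<bar>" "\<bar>db $ i\<bar> \<le> \<bar>b $ i\<bar>" for i j
    using assms by (auto simp: DE comp_bound_def)
  have ratio: "\<bar>p / q\<bar> \<le> 1" "q * (p / q) = p" if "\<bar>p\<bar> \<le> \<bar>q\<bar>" for p q :: real
    using that by (cases "q = 0"; simp add: divide_le_eq_1)+
  show ?thesis
  proof
    define t :: "real^(('n \<times> 'm) + 'm)" where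
      "t = (\<chi> p. case p of Inl (j, i) \<Rightarrow> dA $ i $ j / A $ i $ j | Inr i \<Rightarrow> db $ i / b $ i)"
    show "\<bar>t $ p\<bar> \<le> 1" for p
      by (cases p) (auto simp: t_def le ratio(1) simp del: abs_divide)
    show "scale_data t D = E"
      by (simp add: DE scale_data_def t_def vec_eq_iff le ratio(2) del: times_divide_eq_right)
  qed
qed

text \<open>
  The admissible bounds form a closed set that is bounded below, so their infimum is one of them.
\<close>
lemma comp_bound_Least:
  assumes "comp_bound D E \<omega>"
  shows "comp_bound D E (LEAST \<omega>. comp_bound D E \<omega>)"
proof -
  let ?W = "{\<omega>. comp_bound D E \<omega>}"
  have "closed ?W"
    unfolding comp_bound_def case_prod_beta
    by (intro closed_Collect_conj closed_Collect_all closed_Collect_le continuous_intros)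
  moreover have bdd: "bdd_below ?W"
    by (rule bdd_belowI[of _ 0]) (auto simp: comp_bound_def case_prod_beta)
  ultimately have "Inf ?W \<in> ?W"
    using assms by (intro closed_contains_Inf) auto
  moreover have "Inf ?W \<le> \<omega>'" if "comp_bound D E \<omega>'" for \<omega>'
    using that bdd by (intro cInf_lower) auto
  ultimately show ?thesis
    using Least_equality[of "comp_bound D E" "Inf ?W"] by simp
qed

lemma comp_norm_eq_1_imp_comp_bound:
  assumes "comp_norm D E = 1" shows "comp_bound D E 1"
proof -
  have ex: "\<exists>\<omega>. comp_bound D E \<omega>" and "(LEAST \<omega>. comp_bound D E \<omega>) = 1"
    using assms by (auto simp: comp_norm_def split: if_splits)
  then show ?thesis using comp_bound_Least by metis
qed

text \<open>
  At a nonzero entry of \<open>A\<close> the perturbation is as large as the entry itself, so no bound below one is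
  admissible.
\<close>
lemma comp_norm_scale_data_sign:
  assumes t: "\<And>i. \<bar>t $ i\<bar> = 1" and A: "A \<noteq> 0"
  shows "comp_norm (A, b) (scale_data t (A, b)) = 1"
proof -
  let ?E = "scale_data t (A, b)"
  have bd: "comp_bound (A, b) ?E 1" using t by (intro comp_bound_scale_data) simp
  obtain i j where ij: "A $ i $ j \<noteq> 0" using A by (auto simp: vec_eq_iff)
  have "1 \<le> \<omega>" if "comp_bound (A, b) ?E \<omega>" for \<omega>
  proof -
    have "\<bar>A $ i $ j\<bar> \<le> \<omega> * \<bar>A $ i $ j\<bar>"
      using that by (auto simp: comp_bound_def scale_data_def abs_mult t)
    then show ?thesis using ij by simp
  qed
  then have "(LEAST \<omega>. comp_bound (A, b) ?E \<omega>) = 1"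
    using bd by (intro Least_equality) auto
  then show ?thesis using bd by (auto simp: comp_norm_def)
qed

lemma tls_generic_nonzero:
  fixes A :: "real^'n^'m"
  assumes card: "CARD('n) < CARD('m)" and "tls_generic A b"
  shows "A \<noteq> 0"
proof
  assume "A = 0"
  then have "((sigma_min A)\<^sup>2) * (axis undefined 1 \<bullet> (axis undefined 1 :: real^'n)) \<le> 0"
    using sigma_min_lower[OF card, of A "axis undefined 1"] by simp
  then have "(sigma_min A)\<^sup>2 \<le> 0" by (simp add: inner_axis_axis)
  then show False
    using spectral_gap_pos[OF assms] zero_le_power2[of "sigma_min (augment A b)"] by linarith
qed

theorem theorem3p1:
  fixes A :: "real^'n^'m" and b :: "real^'m" and x :: "real^'n" and r :: "real^'m"
    and P :: "real^'n^'n" and L :: "real^'n^'k" and V :: "real^'k \<Rightarrow> real"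
    and G :: "real^'m^'n" and N :: "real^('n \<times> 'm)^'n" and H :: "real^'m^'n"
    and K :: "real^(('n \<times> 'm) + 'm)^'n"
  assumes "CARD('n) < CARD('m)" and "CARD('k) \<le> CARD('n)"
    and "is_norm V"
    and "tls_generic A b"
    and "tls_solution A b x"
    and "r = b - A *v x"
    and "P = transpose A ** A - (sigma_min (augment A b))\<^sup>2 *\<^sub>R mat 1"
    and "G = transpose A + (2 / (1 + x \<bullet> x)) *\<^sub>R
               ((columnvector x :: real^1^'n) ** (rowvector r :: real^'m^1))"
    and "N = matrix_inv P **
               (drop_fst_row (kron (- (rowvector x :: real^'n^1)) G) +
                drop_snd_row (kron (mat 1 :: real^'n^'n) (rowvector r :: real^'m^1)))"
    and "H = matrix_inv P ** G"
    and "K = hcat (N ** diag_mat (vec_cols A)) (H ** diag_mat b)"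
  shows "attains_max (perturbed_size L V (A, b)) {E. comp_norm (A, b) E = 1} \<and>
         attains_max (\<lambda>u. norm1 (transpose K *v (transpose L *v u))) {u. dual_norm V u = 1} \<and>
         tls_cond L V (A, b) =
           max_over (\<lambda>u. norm1 (transpose K *v (transpose L *v u))) {u. dual_norm V u = 1} \<and>
         max_over (\<lambda>u. norm1 (transpose K *v (transpose L *v u))) {u. dual_norm V u = 1} =
           dual_1_norm V (transpose K ** transpose L)"
proof -
  note card = assms(1) and V = assms(3) and generic = assms(4) and sol = assms(5)
    and r = assms(6) and K = assms(11)
  have P: "P = tls_gram A b" by (simp add: assms(7) tls_gram_def)
  have G: "G *v w = w v* A + (2 * (r \<bullet> w) / (1 + x \<bullet> x)) *\<^sub>R x" for w
  proof -
    have "(columnvector x :: real^1^'n) ** (rowvector r :: real^'m^1) = outer x r"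
      by (simp add: vec_eq_iff matrix_matrix_mult_def columnvector_def rowvector_def outer_def)
    then show ?thesis
      by (simp add: assms(8) matrix_vector_mult_add_rdistrib outer_mult
          scaleR_matrix_vector_assoc[symmetric])
  qed
  have kron: "(drop_fst_row (kron (- (rowvector x :: real^'n^1)) G) +
      drop_snd_row (kron (mat 1 :: real^'n^'n) (rowvector r :: real^'m^1))) *v vec_cols dA
      = G *v (- (dA *v x)) + r v* dA" for dA
  proof -
    have "- (rowvector x :: real^'n^1) = rowvector (- x)"
      by (simp add: vec_eq_iff rowvector_def)
    moreover have "dA *v (- x) = - (dA *v x)"
      by (rule vec.neg)
    ultimately show ?thesis
      by (simp only: matrix_vector_mult_add_rdistrib kron_row_mult_vec_cols kron_mat_1_mult_vec_cols)
  qed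
  have deriv: "frechet_derivative (tls_map L) (at (A, b)) E = (L ** K) *v t"
    if E: "scale_data t (A, b) = E" for t E
  proof -
    obtain dA db where E': "E = (dA, db)" by fastforce
    let ?X' = "\<lambda>(dA, db). matrix_inv P *v ((db - dA *v x) v* A + r v* dA
        + (2 * (r \<bullet> (db - dA *v x)) / (1 + x \<bullet> x)) *\<^sub>R x)"
    have "((\<lambda>D. L *v tls_point D) has_derivative (\<lambda>E. L *v ?X' E)) (at (A, b))"
      using bounded_linear.has_derivative[OF matrix_vector_mul_bounded_linear
          tls_point_has_derivative[OF card generic sol]]
      by (simp add: P r)
    moreover have "(tls_map L :: (real^'n^'m) \<times> (real^'m) \<Rightarrow> _) = (\<lambda>D. L *v tls_point D)"
      by (simp add: tls_map_def tls_point_def case_prod_unfold)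
    ultimately have "(tls_map L has_derivative (\<lambda>E. L *v ?X' E)) (at (A, b))"
      by (simp only:)
    then have "frechet_derivative (tls_map L) (at (A, b)) = (\<lambda>E. L *v ?X' E)"
      by (rule frechet_derivative_at[symmetric])
    moreover have "?X' (dA, db) = K *v t"
    proof -
      have "K *v t = matrix_inv P *v (G *v (- (dA *v x)) + r v* dA + G *v db)"
        unfolding K hcat_diag_mult_scale_data[OF E[unfolded E']] assms(9,10)
        unfolding matrix_vector_mul_assoc[symmetric] kron
        by (simp only: matrix_vector_right_distrib)
      also have "G *v (- (dA *v x)) + r v* dA + G *v db = G *v (db - dA *v x) + r v* dA"
        using matrix_vector_right_distrib[of G db "- (dA *v x)"] by simp
      finally show ?thesis by (simp only: G prod.case ac_simps)
    qed
    ultimately show ?thesis by (simp add: E' matrix_vector_mul_assoc[symmetric])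
  qed
  let ?g = "\<lambda>u. norm1 (transpose K *v (transpose L *v u))"
  have g: "?g = (\<lambda>u. norm1 (transpose (L ** K) *v u))"
    by (simp only: matrix_transpose_mul matrix_vector_mul_assoc)
  note duality = norm_cube_duality[OF V, where B = "L ** K", folded g]
  let ?M = "max_over ?g {u. dual_norm V u = 1}" and ?S = "{E. comp_norm (A, b) E = 1}"
  have upper: "perturbed_size L V (A, b) E \<le> ?M" if "E \<in> ?S" for E
  proof -
    obtain t where t: "\<And>i. \<bar>t $ i\<bar> \<le> 1" and E: "scale_data t (A, b) = E"
      using comp_bound_1_scale_data comp_norm_eq_1_imp_comp_bound \<open>E \<in> ?S\<close> by blast
    then show ?thesis
      using duality(2)[OF t] by (simp only: perturbed_size_def deriv[OF E])
  qed
  obtain t where t: "\<And>i. \<bar>t $ i\<bar> = 1" "V ((L ** K) *v t) = ?M"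
    using duality(3) by blast
  let ?E = "scale_data t (A, b)"
  have E: "?E \<in> ?S" "perturbed_size L V (A, b) ?E = ?M"
    using comp_norm_scale_data_sign[OF t(1) tls_generic_nonzero[OF card generic]] t(2)
    by (simp_all only: perturbed_size_def deriv[OF refl] mem_Collect_eq)
  have "attains_max (perturbed_size L V (A, b)) ?S"
    unfolding attains_max_def using E upper by metis
  moreover have "tls_cond L V (A, b) = ?M"
    unfolding tls_cond_def using max_over_eqI[OF E(1), of "perturbed_size L V (A, b)"] E(2) upper by simp
  moreover have "?M = dual_1_norm V (transpose K ** transpose L)"
    by (simp only: dual_1_norm_def matrix_vector_mul_assoc)
  ultimately show ?thesis using duality(1) by blast
qed

end
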